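(* Let $p$ be a prime with $p \equiv 1 \pmod 3$, let $\alpha \ge 1$ and $q = p^{\alpha}$. Let $L, M$ be integers satisfying $$4q = L^2 + 27M^2, \qquad L \equiv 1 \pmod 3, \qquad p \nmid L.$$ Then the $1\times 2$ matrix $$\left[\ \frac{L+3M}{2},\ \ \frac{L-3M}{2}\ \right]$$ whose integer entries are reduced modulo $p$ and regarded as elements of $\mathbb F_p \subseteq \mathbb F_q$, is a generator matrix of a $[2,1,2]$ MDS code over $\mathbb F_q$.
   Context: An $[n,k,d]$-code over $\mathbb F_q$ is a linear subspace of $\mathbb F_q^n$ of dimension $k$ and minimum (Hamming) distance $d$. It is called MDS (maximum distance separable) if $n+1 = k+d$. A generator matrix of a linear code is a matrix whose rows form a basis of the code. The equation $4q=L^2+27M^2$ forces $L\equiv M \pmod 2$, so $\frac{L\pm 3M}{2}$ are integers. *)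

theory Defs
  imports "HOL-Analysis.Cartesian_Space" "HOL-Computational_Algebra.Primes"
begin

definition hamming_dist :: "'a ^ 'n \<Rightarrow> 'a ^ 'n \<Rightarrow> nat" where
  "hamming_dist x y = card {i. x $ i \<noteq> y $ i}"

text \<open>A relation rather than a function: a code with a single codeword has no minimum distance.\<close>

definition has_min_distance :: "('a ^ 'n) set \<Rightarrow> nat \<Rightarrow> bool" where
  "has_min_distance C d \<longleftrightarrow>
     (\<exists>x\<in>C. \<exists>y\<in>C. x \<noteq> y \<and> hamming_dist x y = d) \<and>
     (\<forall>x\<in>C. \<forall>y\<in>C. x \<noteq> y \<longrightarrow> d \<le> hamming_dist x y)"

definition linear_code :: "nat \<Rightarrow> nat \<Rightarrow> nat \<Rightarrow> ('a::{field,finite} ^ 'n) set \<Rightarrow> bool" where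
  "linear_code n k d C \<longleftrightarrow>
     CARD('n) = n \<and> vec.subspace C \<and> vec.dim C = k \<and> has_min_distance C d"

definition MDS :: "('a::{field,finite} ^ 'n) set \<Rightarrow> bool" where
  "MDS C \<longleftrightarrow> (\<exists>n k d. linear_code n k d C \<and> n + 1 = k + d)"

text \<open>Injectivity is needed because \<^const>\<open>rows\<close> is a set and would hide repeated rows.\<close>

definition generator_matrix :: "'a::{field,finite} ^ 'n ^ 'k \<Rightarrow> ('a ^ 'n) set \<Rightarrow> bool" where
  "generator_matrix G C \<longleftrightarrow>
     inj (\<lambda>i. row i G) \<and> vec.independent (rows G) \<and> vec.span (rows G) = C"

text \<open>
  In a field of order \<open>p ^ \<alpha>\<close>, \<^const>\<open>of_int\<close> is reduction modulo \<open>p\<close>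
  followed by the inclusion of the prime field. When \<open>4 * q = L\<^sup>2 + 27 * M\<^sup>2\<close>,
  \<open>L\<close> and \<open>M\<close> have the same parity, so both integer divisions by 2 are exact.
\<close>

definition LM_matrix :: "int \<Rightarrow> int \<Rightarrow> 'a::{field,finite} ^ 2 ^ 1" where
  "LM_matrix L M =
     vector [vector [of_int ((L + 3 * M) div 2), of_int ((L - 3 * M) div 2)]]"

end

theory Submission
  imports Defs "HOL-Number_Theory.Residues"
begin

text \<open>A single row with no zero entry spans a line on which any two distinct words differ
  everywhere, so for length 2 the code has parameters [2,1,2], and 2 + 1 = 1 + 2 makes it MDS. It
  remains to see that p divides neither entry. With a = (L + 3M)/2 the equation becomes q = a^2 -
  3aM + 9M^2; if p divides a, it divides 3M and hence L = 2a - 3M, a contradiction. The other entry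
  follows by replacing M with -M. The carrying lemmas are \<open>not_dvd_half_L_plus_3M\<close> and
  \<open>linear_code_span_singleton\<close>.\<close>

text \<open>The characteristic is a prime dividing the order \<open>p ^ \<alpha>\<close> of the
  field, hence it is \<open>p\<close>.\<close>

lemma of_int_eq_0_iff_prime_dvd:
  fixes p \<alpha> :: nat and x :: int
  assumes "prime p" and "CARD('a::{field,finite}) = p ^ \<alpha>"
  shows "of_int x = (0::'a) \<longleftrightarrow> int p dvd x"
proof -
  have "CHAR('a) dvd p ^ \<alpha>"
    using CHAR_dvd_CARD[where 'a='a] assms(2) by simp
  moreover have "prime CHAR('a)"
    using finite_imp_CHAR_pos[where 'a='a] prime_CHAR_semidom[where 'a='a] by simp
  ultimately have "CHAR('a) = p"
    using assms(1) by (metis prime_dvd_power primes_dvd_imp_eq)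
  then show ?thesis
    by (simp add: of_int_eq_0_iff_char_dvd)
qed

lemma not_dvd_half_L_plus_3M:
  fixes p :: nat and q L M :: int
  assumes "prime p" and "int p dvd q"
    and eq: "4 * q = L\<^sup>2 + 27 * M\<^sup>2" and "\<not> int p dvd L"
  shows "\<not> int p dvd (L + 3 * M) div 2"
proof
  define a where "a = (L + 3 * M) div 2"
  assume "int p dvd (L + 3 * M) div 2"
  then have pa: "int p dvd a" by (simp add: a_def)
  \<comment> \<open>Parity makes the division by 2 exact, so that \<open>L\<close> can be recovered
    from \<open>a\<close> and \<open>M\<close>.\<close>
  have "even (L\<^sup>2 + 27 * M\<^sup>2)" unfolding eq[symmetric] by simp
  then have "even (L + 3 * M)" by simp
  then have L: "L = 2 * a - 3 * M" by (simp add: a_def)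
  have "q = a\<^sup>2 - 3 * a * M + 9 * M\<^sup>2"
    using eq unfolding L by (simp add: power2_eq_square algebra_simps)
  then have "9 * M\<^sup>2 = q - a * (a - 3 * M)"
    by (simp add: power2_eq_square algebra_simps)
  then have "int p dvd 9 * M\<^sup>2"
    using pa \<open>int p dvd q\<close> by simp
  \<comment> \<open>Written as a square, so that primality applies to \<open>3 * M\<close> as a
    whole; this is the multiple of \<open>M\<close> that occurs in \<open>L\<close>.\<close>
  then have "int p dvd (3 * M)\<^sup>2" by (simp add: power_mult_distrib)
  then have "int p dvd 3 * M"
    using \<open>prime p\<close> prime_dvd_power[of "int p" "3 * M" 2] by simp
  then have "int p dvd L" unfolding L using pa by simp
  with \<open>\<not> int p dvd L\<close> show False by simp
qed

text \<open>Two distinct words are \<open>c *s v\<close> and \<open>d *s v\<close> with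
  \<open>c\<close> and \<open>d\<close> different; their difference \<open>(c - d) *s v\<close>
  vanishes nowhere, so every distance between distinct words is the full length.\<close>

lemma linear_code_span_singleton:
  fixes v :: "'a::{field,finite} ^ 'n"
  assumes nz: "\<And>i. v $ i \<noteq> 0"
  shows "linear_code CARD('n) 1 CARD('n) (vec.span {v})"
proof -
  have "v \<noteq> 0" using nz by auto
  have dist: "hamming_dist x y = CARD('n)"
    if xy: "x \<in> vec.span {v}" "y \<in> vec.span {v}" "x \<noteq> y" for x y
  proof -
    obtain c d where "x = c *s v" "y = d *s v"
      using xy by (auto simp: vec.span_singleton)
    moreover from this have "c \<noteq> d" using \<open>x \<noteq> y\<close> by auto
    ultimately show ?thesis using nz by (simp add: hamming_dist_def)
  qed
  have "vec.dim (vec.span {v}) = 1"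
    using \<open>v \<noteq> 0\<close> vec.dim_eq_card_independent[of "{v}"] by (simp add: vec.dim_span)
  \<comment> \<open>These two words witness that the minimum distance is attained.\<close>
  moreover have "v \<in> vec.span {v}" "0 \<in> vec.span {v}"
    by (simp_all add: vec.span_base vec.span_zero)
  ultimately show ?thesis
    unfolding linear_code_def has_min_distance_def
    using \<open>v \<noteq> 0\<close> dist vec.subspace_span by fastforce
qed

theorem mainTheorem1:
  fixes p \<alpha> q :: nat and L M :: int
  assumes "prime p" and "p mod 3 = 1" and "\<alpha> \<ge> 1" and "q = p ^ \<alpha>"
    and "CARD('a::{field,finite}) = q"
    and "4 * int q = L\<^sup>2 + 27 * M\<^sup>2"
    and "L mod 3 = 1"
    and "\<not> int p dvd L"
  shows "\<exists>C :: ('a ^ 2) set. linear_code 2 1 2 C \<and> MDS C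
           \<and> generator_matrix (LM_matrix L M :: 'a ^ 2 ^ 1) C"
proof -
  let ?G = "LM_matrix L M :: 'a ^ 2 ^ 1"
  define v where "v = row 1 ?G"
  have "int p dvd int q" using assms(3,4) by simp
  \<comment> \<open>The equation is even in \<open>M\<close>, so the instance at \<open>- M\<close>
    settles the second entry.\<close>
  then have "\<not> int p dvd (L + 3 * M) div 2" "\<not> int p dvd (L - 3 * M) div 2"
    using not_dvd_half_L_plus_3M[of p "int q" L M] not_dvd_half_L_plus_3M[of p "int q" L "- M"]
      assms by simp_all
  moreover have "CARD('a) = p ^ \<alpha>" using assms by simp
  ultimately have nz: "v $ i \<noteq> 0" for i
    using exhaust_2[of i] of_int_eq_0_iff_prime_dvd[where 'a='a, OF \<open>prime p\<close>]
    by (auto simp: v_def row_def LM_matrix_def vector_1 vector_2)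
  have code: "linear_code 2 1 2 (vec.span {v})"
    using linear_code_span_singleton[OF nz] by simp
  moreover have "MDS (vec.span {v})"
    unfolding MDS_def using code by force
  moreover have "rows ?G = {v}"
    by (auto simp: rows_def v_def num1_eq1)
  moreover have "v \<noteq> 0" using nz by auto
  \<comment> \<open>Injectivity of the rows is automatic, as the row index type has one
    element.\<close>
  ultimately have "generator_matrix ?G (vec.span {v})"
    by (simp add: generator_matrix_def inj_def)
  with code \<open>MDS (vec.span {v})\<close> show ?thesis by blast
qed

end
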